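(* Let $d\ge1$ be an integer and let $A_1,A_2,B_1,B_2,C_1,C_2,C_3$ be matrices in $\mathbb{C}^{d\times d}$ such that $C_j+kI$ is invertible for $j=1,2,3$ and all integers $k\ge0$, and such that $A_1A_2=A_2A_1$, $B_1B_2=B_2B_1$, $B_iC_j=C_jB_i$ for $i=1,2$ and $j=1,2,3$, and $C_iC_j=C_jC_i$ for $i,j=1,2,3$. Then the matrix function $U=F_3(A_1,A_2,A_2,B_1,B_2,B_1;C_1,C_2,C_3;x,y,z)$ satisfies, on the interior of the region of absolute convergence of its defining series, the system $$x(1-x)U_{xx}-xzU_{xz}+U_x\big(C_1-(B_1+I)x\big)-A_1(xU_x+zU_z)-A_1UB_1=0,$$ $$y(1-y)U_{yy}-yzU_{yz}+U_y\big(C_2-(B_2+I)y\big)-zU_zB_2-yA_2U_y-A_2UB_2=0,$$ $$z(1-z)U_{zz}-(xyU_{xy}+yzU_{yz}+xzU_{xz})+U_z\big(C_3-(B_1+I)z\big)-yU_yB_1-A_2(xU_x+zU_z)-A_2UB_1=0.$$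
   Context: For $M\in\mathbb{C}^{d\times d}$, the Pochhammer symbol is $(M)_0=I$ and $(M)_k=M(M+I)\cdots(M+(k-1)I)$ for $k\ge1$; $(M)_k^{-1}$ denotes the inverse matrix of $(M)_k$. Matrix products are taken in the written order. For complex variables $x,y,z$, $$F_3(A_1,A_2,A_2,B_1,B_2,B_1;C_1,C_2,C_3;x,y,z)=\sum_{m,n,p=0}^{\infty}(A_1)_m(A_2)_{n+p}(B_1)_{m+p}(B_2)_n(C_1)_m^{-1}(C_2)_n^{-1}(C_3)_p^{-1}\,\frac{x^my^nz^p}{m!\,n!\,p!}.$$ Subscripts on $U$ denote partial derivatives, e.g. $U_x=\partial U/\partial x$, $U_{xz}=\partial^2U/\partial x\partial z$. *)

theory Defs
  imports "HOL-Analysis.Analysis"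
begin

text \<open>Matrices in \<open>\<complex>\<^sup>d\<^sup>\<times>\<^sup>d\<close> are elements of \<^typ>\<open>complex^'d^'d\<close>, with the matrix product \<open>**\<close>;
  the operation \<open>*\<close> on this type is entrywise. Being nonempty, the finite index type \<open>'d\<close>
  ranges over all dimensions \<open>d \<ge> 1\<close>.\<close>

definition cscale :: "complex \<Rightarrow> complex^'d^'d \<Rightarrow> complex^'d^'d"  (infixr "*\<^sub>M" 75)
  where "c *\<^sub>M A = (\<chi> i j. c * A $ i $ j)"

text \<open>The library's \<^const>\<open>pochhammer\<close> needs a commutative multiplication.\<close>

primrec mpoch :: "complex^'d^'d \<Rightarrow> nat \<Rightarrow> complex^'d^'d"
  where
    "mpoch M 0 = mat 1"
  | "mpoch M (Suc k) = mpoch M k ** (M + mat (of_nat k))"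

definition F3_term ::
  "complex^'d^'d \<Rightarrow> complex^'d^'d \<Rightarrow> complex^'d^'d \<Rightarrow> complex^'d^'d \<Rightarrow>
   complex^'d^'d \<Rightarrow> complex^'d^'d \<Rightarrow> complex^'d^'d \<Rightarrow>
   complex \<Rightarrow> complex \<Rightarrow> complex \<Rightarrow> nat \<times> nat \<times> nat \<Rightarrow> complex^'d^'d"
  where "F3_term A1 A2 B1 B2 C1 C2 C3 x y z = (\<lambda>(m, n, p).
    ((x ^ m * y ^ n * z ^ p) / (fact m * fact n * fact p)) *\<^sub>M
      (mpoch A1 m ** mpoch A2 (n + p) ** mpoch B1 (m + p) ** mpoch B2 n
        ** matrix_inv (mpoch C1 m) ** matrix_inv (mpoch C2 n) ** matrix_inv (mpoch C3 p)))"

text \<open>\<open>F3 A1 A2 B1 B2 C1 C2 C3 x y z\<close> is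
  \<open>F\<^sub>3(A\<^sub>1, A\<^sub>2, A\<^sub>2, B\<^sub>1, B\<^sub>2, B\<^sub>1; C\<^sub>1, C\<^sub>2, C\<^sub>3; x, y, z)\<close>; the repeated parameters are not
  repeated as arguments.\<close>

definition F3 ::
  "complex^'d^'d \<Rightarrow> complex^'d^'d \<Rightarrow> complex^'d^'d \<Rightarrow> complex^'d^'d \<Rightarrow>
   complex^'d^'d \<Rightarrow> complex^'d^'d \<Rightarrow> complex^'d^'d \<Rightarrow>
   complex \<Rightarrow> complex \<Rightarrow> complex \<Rightarrow> complex^'d^'d"
  where "F3 A1 A2 B1 B2 C1 C2 C3 x y z = infsum (F3_term A1 A2 B1 B2 C1 C2 C3 x y z) UNIV"

text \<open>The norm on \<^typ>\<open>complex^'d^'d\<close> is the Frobenius norm; as all norms on this space are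
  equivalent, the region does not depend on that choice.\<close>

definition F3_region ::
  "complex^'d^'d \<Rightarrow> complex^'d^'d \<Rightarrow> complex^'d^'d \<Rightarrow> complex^'d^'d \<Rightarrow>
   complex^'d^'d \<Rightarrow> complex^'d^'d \<Rightarrow> complex^'d^'d \<Rightarrow> (complex \<times> complex \<times> complex) set"
  where "F3_region A1 A2 B1 B2 C1 C2 C3 =
    {(x, y, z). (\<lambda>k. norm (F3_term A1 A2 B1 B2 C1 C2 C3 x y z k)) summable_on UNIV}"

text \<open>Complex derivatives of matrix functions are taken entrywise (\<^const>\<open>deriv\<close> is only available
  for functions with values in the field itself). As \<^const>\<open>deriv\<close> is total, the existence
  of the derivative is the separate predicate \<open>mdifferentiable\<close>.\<close>

definition mderiv :: "(complex \<Rightarrow> complex^'d^'d) \<Rightarrow> complex \<Rightarrow> complex^'d^'d"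
  where "mderiv f t = (\<chi> i j. deriv (\<lambda>s. f s $ i $ j) t)"

definition mdifferentiable :: "(complex \<Rightarrow> complex^'d^'d) \<Rightarrow> complex \<Rightarrow> bool"
  where "mdifferentiable f t \<longleftrightarrow> (\<forall>i j. (\<lambda>s. f s $ i $ j) field_differentiable (at t))"

type_synonym 'd matfun3 = "complex \<Rightarrow> complex \<Rightarrow> complex \<Rightarrow> complex^'d^'d"

definition pdx :: "'d::finite matfun3 \<Rightarrow> 'd matfun3"
  where "pdx F x y z = mderiv (\<lambda>t. F t y z) x"

definition pdy :: "'d::finite matfun3 \<Rightarrow> 'd matfun3"
  where "pdy F x y z = mderiv (\<lambda>t. F x t z) y"

definition pdz :: "'d::finite matfun3 \<Rightarrow> 'd matfun3"
  where "pdz F x y z = mderiv (\<lambda>t. F x y t) z"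

definition has_partials :: "'d::finite matfun3 \<Rightarrow> complex \<Rightarrow> complex \<Rightarrow> complex \<Rightarrow> bool"
  where "has_partials F x y z \<longleftrightarrow>
    mdifferentiable (\<lambda>t. F t y z) x \<and>
    mdifferentiable (\<lambda>t. F x t z) y \<and>
    mdifferentiable (\<lambda>t. F x y t) z"

text \<open>All first and second order partial derivatives exist at the point. That \<open>pdx F\<close> etc. are the
  true first order derivatives near the point, as a second order derivative requires,
  follows when this holds throughout an open set.\<close>

definition has_partials2 :: "'d::finite matfun3 \<Rightarrow> complex \<Rightarrow> complex \<Rightarrow> complex \<Rightarrow> bool"
  where "has_partials2 F x y z \<longleftrightarrow>
    has_partials F x y z \<and> has_partials (pdx F) x y z \<and>
    has_partials (pdy F) x y z \<and> has_partials (pdz F) x y z"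

end

theory Submission
  imports Defs
begin

text \<open>
  Write \<open>U = \<Sum> K(m,n,p) x\<^sup>m y\<^sup>n z\<^sup>p\<close> with matrix coefficients \<open>K(m,n,p)\<close>, and let \<open>K\<^sub>x\<close>, \<open>K\<^sub>y\<close>, \<open>K\<^sub>z\<close>
  be the coefficients of \<open>U\<^sub>x\<close>, \<open>U\<^sub>y\<close>, \<open>U\<^sub>z\<close>, such as \<open>K\<^sub>x(m,n,p) = (m+1) K(m+1,n,p)\<close>. Raising one index
  by 1 lengthens two Pochhammer symbols and one inverse Pochhammer symbol by a single factor. The
  commutation hypotheses let a new factor coming from \<open>A\<^sub>1\<close> or \<open>A\<^sub>2\<close> travel to the far left, a new
  factor from \<open>B\<^sub>1\<close> or \<open>B\<^sub>2\<close> to the far right, and they let a factor \<open>C\<^sub>j + k\<close> multiplied on the right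
  reach the inverse factor that it cancels. This gives (lemma \<open>F3_coeff_recurrence\<close>)
    \<^item> \<open>K\<^sub>x (C\<^sub>1 + m) = (A\<^sub>1 + m) K (B\<^sub>1 + m + p)\<close>,
    \<^item> \<open>K\<^sub>y (C\<^sub>2 + n) = (A\<^sub>2 + n + p) K (B\<^sub>2 + n)\<close>,
    \<^item> \<open>K\<^sub>z (C\<^sub>3 + p) = (A\<^sub>2 + n + p) K (B\<^sub>1 + m + p)\<close>.

  The operators \<open>x \<partial>/\<partial>x\<close>, \<open>y \<partial>/\<partial>y\<close>, \<open>z \<partial>/\<partial>z\<close> multiply the coefficients by \<open>m\<close>, \<open>n\<close>, \<open>p\<close>. Each of the
  three differential equations, read coefficient by coefficient, is therefore one of these three
  recurrences multiplied out (lemmas \<open>F3_first_equation\<close>,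
  \<open>F3_second_equation\<close>, \<open>F3_third_equation\<close>).

  The analytic part is that \<open>U\<close> may be differentiated term by term. A point in the interior of the
  region of absolute convergence lies in an open polydisc centred at the origin on which the series
  converges absolutely: move each coordinate slightly outwards along its ray and use that absolute
  convergence depends only on the absolute values of the variables. On that polydisc the predicate
  \<open>expansion F K R S T\<close>, saying that \<open>F\<close> is the sum of the series with coefficients \<open>K\<close>, passes from
  \<open>F\<close> to its partial derivatives (lemma \<open>expansion_xdiff\<close>), so it can be iterated to reach the second
  order.
\<close>

section \<open>Differentiation of series in powers of one variable\<close>

text \<open>Differentiation costs a factor \<open>m + 1\<close> in the coefficients, which the geometric decay of \<open>(r / s)\<^sup>m\<close>
  absorbs. The second index \<open>k\<close> is an arbitrary parameter; later it collects the exponents of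
  the two variables that are kept fixed.\<close>

lemma summable_on_shifted_coefficients:
  fixes g :: "nat \<times> 'k \<Rightarrow> real"
  assumes nonneg: "\<And>q. 0 \<le> g q"
    and summable: "(\<lambda>(m, k). g (m, k) * s ^ m) summable_on UNIV"
    and r: "0 \<le> r" "r < s"
  shows "(\<lambda>(m, k). real (Suc m) * g (Suc m, k) * r ^ m) summable_on UNIV"
proof -
  have s: "s > 0" using r by simp
  have "(\<lambda>m. real m * (r / s) ^ m) \<longlonglongrightarrow> 0"
    using powser_times_n_limit_0[of "r / s"] r s by simp
  moreover have "(\<lambda>m. (r / s) ^ m) \<longlonglongrightarrow> 0"
    using r s by (intro LIMSEQ_power_zero) simp
  ultimately have "(\<lambda>m. real m * (r / s) ^ m + (r / s) ^ m) \<longlonglongrightarrow> 0 + 0"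
    by (rule tendsto_add)
  then have "Bseq (\<lambda>m. real m * (r / s) ^ m + (r / s) ^ m)"
    by (intro convergent_imp_Bseq) (auto simp: convergent_def)
  then obtain M where M: "\<And>m. norm (real m * (r / s) ^ m + (r / s) ^ m) \<le> M"
    by (auto simp: Bseq_def)
  have bound: "real (Suc m) * r ^ m \<le> (M / s) * s ^ Suc m" for m
  proof -
    have "real (Suc m) * r ^ m = (real m * (r / s) ^ m + (r / s) ^ m) * s ^ m"
      using s by (simp add: field_simps)
    also have "\<dots> \<le> M * s ^ m"
      using M[of m] s by (intro mult_right_mono) auto
    finally show ?thesis using s by simp
  qed
  have "inj (\<lambda>(m, k :: 'k). (Suc m, k))" by (auto simp: inj_on_def)
  moreover have "(\<lambda>(m, k). g (m, k) * s ^ m) summable_on range (\<lambda>(m, k :: 'k). (Suc m, k))"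
    by (rule summable_on_subset_banach[OF summable]) simp
  ultimately have "(\<lambda>(m, k). g (Suc m, k) * s ^ Suc m) summable_on UNIV"
    by (subst (asm) summable_on_reindex) (auto simp: o_def case_prod_unfold)
  then have "(\<lambda>q. (M / s) * (case q of (m, k) \<Rightarrow> g (Suc m, k) * s ^ Suc m)) summable_on UNIV"
    by (rule summable_on_cmult_right)
  then show ?thesis
  proof (rule summable_on_comparison_test)
    fix q :: "nat \<times> 'k"
    obtain m k where q: "q = (m, k)" by (cases q)
    have "g (Suc m, k) * (real (Suc m) * r ^ m) \<le> g (Suc m, k) * ((M / s) * s ^ Suc m)"
      by (intro mult_left_mono bound nonneg)
    then show "(case q of (m, k) \<Rightarrow> real (Suc m) * g (Suc m, k) * r ^ m)
        \<le> (M / s) * (case q of (m, k) \<Rightarrow> g (Suc m, k) * s ^ Suc m)"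
      using s by (simp add: q mult_ac)
    show "0 \<le> (case q of (m, k) \<Rightarrow> real (Suc m) * g (Suc m, k) * r ^ m)"
      using nonneg r by (simp add: q)
  qed
qed

text \<open>Absolute convergence permits summation over \<open>k\<close> first. The double series becomes an ordinary
  power series, to which the classical theorem on term-by-term differentiation applies.\<close>

lemma infsum_as_power_series:
  fixes c :: "nat \<times> 'k \<Rightarrow> complex"
  assumes "(\<lambda>(m, k). norm (c (m, k)) * norm t ^ m) summable_on UNIV"
  shows "summable (\<lambda>m. (\<Sum>\<^sub>\<infinity>k. c (m, k)) * t ^ m)"
    and "(\<Sum>\<^sub>\<infinity>(m, k). c (m, k) * t ^ m) = (\<Sum>m. (\<Sum>\<^sub>\<infinity>k. c (m, k)) * t ^ m)"
proof -
  have "(\<lambda>q. norm (case q of (m, k) \<Rightarrow> c (m, k) * t ^ m)) summable_on UNIV"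
    using assms by (simp add: case_prod_unfold norm_mult norm_power)
  then have "(\<lambda>(m, k). c (m, k) * t ^ m) summable_on UNIV"
    by (rule abs_summable_summable)
  then have *: "(\<lambda>(m, k). c (m, k) * t ^ m) summable_on (SIGMA m:UNIV. UNIV)"
    by simp
  have "(\<lambda>m. \<Sum>\<^sub>\<infinity>k. c (m, k) * t ^ m) summable_on UNIV"
    using summable_on_Sigma_banach[OF *] by simp
  then have sum: "(\<lambda>m. (\<Sum>\<^sub>\<infinity>k. c (m, k)) * t ^ m) summable_on UNIV"
    by (simp add: infsum_cmult_left')
  then have sums: "(\<lambda>m. (\<Sum>\<^sub>\<infinity>k. c (m, k)) * t ^ m) sums (\<Sum>\<^sub>\<infinity>m. (\<Sum>\<^sub>\<infinity>k. c (m, k)) * t ^ m)"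
    by (intro has_sum_imp_sums has_sum_infsum)
  then show "summable (\<lambda>m. (\<Sum>\<^sub>\<infinity>k. c (m, k)) * t ^ m)" by (rule sums_summable)
  have "(\<Sum>\<^sub>\<infinity>(m, k). c (m, k) * t ^ m) = (\<Sum>\<^sub>\<infinity>m. \<Sum>\<^sub>\<infinity>k. c (m, k) * t ^ m)"
    using infsum_Sigma'_banach[OF *] by simp
  then show "(\<Sum>\<^sub>\<infinity>(m, k). c (m, k) * t ^ m) = (\<Sum>m. (\<Sum>\<^sub>\<infinity>k. c (m, k)) * t ^ m)"
    using sums by (simp add: infsum_cmult_left' sums_iff)
qed

lemma has_field_derivative_infsum_powers:
  fixes c :: "nat \<times> 'k \<Rightarrow> complex"
  assumes conv: "\<And>r. 0 \<le> r \<Longrightarrow> r < R \<Longrightarrow> (\<lambda>(m, k). norm (c (m, k)) * r ^ m) summable_on UNIV"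
    and t: "norm t < R"
  shows "((\<lambda>t. \<Sum>\<^sub>\<infinity>(m, k). c (m, k) * t ^ m) has_field_derivative
          (\<Sum>\<^sub>\<infinity>(m, k). of_nat (Suc m) * c (Suc m, k) * t ^ m)) (at t)"
proof -
  define a where "a m = (\<Sum>\<^sub>\<infinity>k. c (m, k))" for m
  have "((\<lambda>t. \<Sum>m. a m * t ^ m) has_field_derivative (\<Sum>m. diffs a m * t ^ m)) (at t)"
  proof (rule termdiffs_strong'[OF _ t])
    fix u :: complex assume "norm u < R"
    then show "summable (\<lambda>m. a m * u ^ m)"
      unfolding a_def by (intro infsum_as_power_series(1) conv) auto
  qed
  moreover have "(\<Sum>m. a m * u ^ m) = (\<Sum>\<^sub>\<infinity>(m, k). c (m, k) * u ^ m)" if "u \<in> ball 0 R" for u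
    unfolding a_def using that by (intro infsum_as_power_series(2)[symmetric] conv) auto
  ultimately have deriv: "((\<lambda>t. \<Sum>\<^sub>\<infinity>(m, k). c (m, k) * t ^ m) has_field_derivative
      (\<Sum>m. diffs a m * t ^ m)) (at t)"
    using t by (auto intro: has_field_derivative_transform_within_open[where S = "ball 0 R"])
  \<comment> \<open>The derivative is expanded back into a double series: its coefficients satisfy the hypothesis
    of \<open>infsum_as_power_series\<close> at the point \<open>t\<close> itself.\<close>
  have "diffs a m = (\<Sum>\<^sub>\<infinity>k. of_nat (Suc m) * c (Suc m, k))" for m
    by (simp add: diffs_def a_def infsum_cmult_right')
  moreover obtain r where r: "norm t < r" "r < R" using dense t by blast
  then have "0 \<le> r" using norm_ge_zero[of t] by linarith
  then have "(\<lambda>(m, k). real (Suc m) * norm (c (Suc m, k)) * norm t ^ m) summable_on UNIV"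
    using r conv[of r] by (intro summable_on_shifted_coefficients[where s = r]) auto
  then have "(\<lambda>(m, k). norm (of_nat (Suc m) * c (Suc m, k)) * norm t ^ m) summable_on UNIV"
    by (simp add: norm_mult del: of_nat_Suc)
  then have "(\<Sum>\<^sub>\<infinity>(m, k). of_nat (Suc m) * c (Suc m, k) * t ^ m)
      = (\<Sum>m. (\<Sum>\<^sub>\<infinity>k. of_nat (Suc m) * c (Suc m, k)) * t ^ m)"
    using infsum_as_power_series(2)[of "\<lambda>(m, k). of_nat (Suc m) * c (Suc m, k)" t] by simp
  ultimately show ?thesis using deriv by simp
qed

section \<open>Matrix algebra\<close>

lemma cscale_nth [simp]: "(c *\<^sub>M A) $ i $ j = c * A $ i $ j"
  by (simp add: cscale_def)

lemma cscale_cscale: "a *\<^sub>M b *\<^sub>M A = (a * b) *\<^sub>M A"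
  by (simp add: vec_eq_iff mult.assoc)

lemma norm_cscale: "norm (c *\<^sub>M A) = norm c * norm A"
  by (simp add: norm_vec_def cscale_def norm_mult L2_set_right_distrib)

lemma cscale_mult_left: "(c *\<^sub>M A) ** B = c *\<^sub>M (A ** B)"
  by (simp add: vec_eq_iff matrix_matrix_mult_def sum_distrib_left mult_ac)

lemma cscale_mult_right: "A ** (c *\<^sub>M B) = c *\<^sub>M (A ** B)"
  by (simp add: vec_eq_iff matrix_matrix_mult_def sum_distrib_left mult_ac)

lemma mult_mat_right: "A ** mat c = c *\<^sub>M A" for A :: "complex^'d^'d"
  by (simp add: vec_eq_iff matrix_matrix_mult_def mat_def mult_delta_left mult_delta_right)

lemma mult_mat_left: "mat c ** A = c *\<^sub>M A" for A :: "complex^'d^'d"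
  by (simp add: vec_eq_iff matrix_matrix_mult_def mat_def mult_delta_left mult_delta_right)

lemma linear_cscale: "linear (\<lambda>A. c *\<^sub>M A)"
  by (rule linearI) (simp_all add: vec_eq_iff algebra_simps)

lemma linear_mult_left: "linear (\<lambda>A. B ** A)"
  for B :: "complex^'d^'d"
  by (rule linearI)
    (simp_all add: vec_eq_iff matrix_matrix_mult_def algebra_simps sum.distrib scaleR_right.sum)

lemma linear_mult_right: "linear (\<lambda>A. A ** B)"
  for B :: "complex^'d^'d"
  by (rule linearI)
    (simp_all add: vec_eq_iff matrix_matrix_mult_def algebra_simps sum.distrib scaleR_right.sum)

lemmas mult_distrib =
  linear_add[OF linear_mult_left] linear_diff[OF linear_mult_left]
  linear_add[OF linear_mult_right] linear_diff[OF linear_mult_right]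

lemmas matrix_expand = mult_distrib mult_mat_left mult_mat_right cscale_mult_left cscale_mult_right

lemma matrix_inv:
  assumes "invertible A"
  shows "A ** matrix_inv A = mat 1" and "matrix_inv A ** A = mat 1"
  using someI_ex[OF assms[unfolded invertible_def]] by (simp_all add: matrix_inv_def)

lemma commute_matrix_inv:
  fixes A B :: "complex^'d^'d"
  assumes "invertible B" "A ** B = B ** A"
  shows "A ** matrix_inv B = matrix_inv B ** A"
proof -
  have "A ** matrix_inv B = matrix_inv B ** (B ** A) ** matrix_inv B"
    by (simp add: matrix_mul_assoc matrix_inv assms(1))
  also have "\<dots> = matrix_inv B ** A ** (B ** matrix_inv B)"
    by (simp add: matrix_mul_assoc flip: assms(2))
  finally show ?thesis by (simp add: matrix_inv assms(1))
qed

lemma commute_add_mat: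
  fixes A B :: "complex^'d^'d"
  assumes "A ** B = B ** A"
  shows "A ** (B + mat c) = (B + mat c) ** A"
  by (simp add: mult_distrib mult_mat_left mult_mat_right assms)

lemma commute_mpoch:
  assumes "A ** B = B ** A"
  shows "A ** mpoch B k = mpoch B k ** A"
proof (induction k)
  case (Suc k)
  then show ?case
    using commute_add_mat[OF assms, of "of_nat k"]
    by (metis matrix_mul_assoc mpoch.simps(2))
qed simp

lemma mpoch_Suc_left: "mpoch A (Suc k) = (A + mat (of_nat k)) ** mpoch A k"
  using commute_mpoch[of "A + mat (of_nat k)" A k] commute_add_mat[of A A "of_nat k"] by simp

lemma invertible_mpoch:
  assumes "\<And>k. invertible (C + mat (of_nat k))"
  shows "invertible (mpoch C k)"
proof (induction k)
  case 0
  show ?case unfolding invertible_def by (rule exI[of _ "mat 1"]) simp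
next
  case (Suc k)
  then show ?case by (simp add: invertible_mult assms)
qed

text \<open>The Pochhammer symbol of length \<open>k + 1\<close> is read with its newest factor on the left, so that in the
  inverse this factor is on the right, where multiplication by \<open>C + k\<close> cancels it.\<close>

lemma matrix_inv_mpoch_Suc:
  fixes C :: "complex^'d^'d"
  assumes "\<And>k. invertible (C + mat (of_nat k))"
  shows "matrix_inv (mpoch C (Suc k)) ** (C + mat (of_nat k)) = matrix_inv (mpoch C k)"
    (is "?I ** ?D = ?J")
proof -
  have "?I ** ?D = ?I ** (?D ** mpoch C k) ** ?J"
    by (simp add: matrix_inv invertible_mpoch assms flip: matrix_mul_assoc)
  also have "\<dots> = ?I ** mpoch C (Suc k) ** ?J"
    by (simp only: mpoch_Suc_left)
  also have "\<dots> = ?J"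
    by (simp add: matrix_inv(2) invertible_mpoch assms del: mpoch.simps)
  finally show ?thesis .
qed

text \<open>The next two lemmas lift an identity for a product \<open>X ** Y\<close> to a right-nested product with further
  factors. Instantiated with particular commuting pairs, they are terminating rewrite rules that
  transport a factor through a long product.\<close>

lemma swap_in_product: "X ** Y = Y ** X \<Longrightarrow> X ** (Y ** Z) = Y ** (X ** Z)"
  for X Y Z :: "complex^'d^'d"
  by (simp add: matrix_mul_assoc)

lemma absorb_in_product: "X ** Y = W \<Longrightarrow> X ** (Y ** Z) = W ** Z"
  for X Y Z :: "complex^'d^'d"
  by (simp add: matrix_mul_assoc)

section \<open>Matrix-valued power series in three variables\<close>

definition monomial3 :: "'a::comm_semiring_1 \<Rightarrow> 'a \<Rightarrow> 'a \<Rightarrow> nat \<times> nat \<times> nat \<Rightarrow> 'a"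
  where "monomial3 x y z = (\<lambda>(m, n, p). x ^ m * y ^ n * z ^ p)"

type_synonym 'd coeffs = "nat \<times> nat \<times> nat \<Rightarrow> complex^'d^'d"

definition has_series ::
  "'d::finite coeffs \<Rightarrow> complex \<Rightarrow> complex \<Rightarrow> complex \<Rightarrow> complex^'d^'d \<Rightarrow> bool"
  where "has_series K x y z V \<longleftrightarrow> ((\<lambda>k. monomial3 x y z k *\<^sub>M K k) has_sum V) UNIV"

text \<open>For \<open>r = \<bar>x\<bar>\<close>, \<open>s = \<bar>y\<bar>\<close>, \<open>t = \<bar>z\<bar>\<close> this is absolute convergence at \<open>(x, y, z)\<close>.\<close>

definition abs_conv :: "'d::finite coeffs \<Rightarrow> real \<Rightarrow> real \<Rightarrow> real \<Rightarrow> bool"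
  where "abs_conv K r s t \<longleftrightarrow> (\<lambda>k. monomial3 r s t k * norm (K k)) summable_on UNIV"

text \<open>Requiring absolute convergence at all smaller radii, rather than at \<open>(R, S, T)\<close>, makes the
  predicate stable under differentiation: the radii need not shrink.\<close>

definition expansion ::
  "'d::finite matfun3 \<Rightarrow> 'd coeffs \<Rightarrow> real \<Rightarrow> real \<Rightarrow> real \<Rightarrow> bool"
  where "expansion F K R S T \<longleftrightarrow>
    (\<forall>r s t. 0 \<le> r \<and> r < R \<and> 0 \<le> s \<and> s < S \<and> 0 \<le> t \<and> t < T \<longrightarrow> abs_conv K r s t) \<and>
    (\<forall>x y z. norm x < R \<and> norm y < S \<and> norm z < T \<longrightarrow> has_series K x y z (F x y z))"

definition xdiff :: "'d::finite coeffs \<Rightarrow> 'd coeffs"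
  where "xdiff K = (\<lambda>(m, n, p). of_nat (Suc m) *\<^sub>M K (Suc m, n, p))"

definition ydiff :: "'d::finite coeffs \<Rightarrow> 'd coeffs"
  where "ydiff K = (\<lambda>(m, n, p). of_nat (Suc n) *\<^sub>M K (m, Suc n, p))"

definition zdiff :: "'d::finite coeffs \<Rightarrow> 'd coeffs"
  where "zdiff K = (\<lambda>(m, n, p). of_nat (Suc p) *\<^sub>M K (m, n, Suc p))"

text \<open>The roles of the variables are exchanged by permuting the exponents. Thus
  term-by-term differentiation and the action of the Euler operators are established for \<open>x\<close> and
  transferred to \<open>y\<close> and \<open>z\<close>.\<close>

definition swap_xy :: "nat \<times> nat \<times> nat \<Rightarrow> nat \<times> nat \<times> nat"
  where "swap_xy = (\<lambda>(m, n, p). (n, m, p))"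

definition swap_xz :: "nat \<times> nat \<times> nat \<Rightarrow> nat \<times> nat \<times> nat"
  where "swap_xz = (\<lambda>(m, n, p). (p, n, m))"

lemma bij_swap: "bij swap_xy" "bij swap_xz"
  by (auto intro!: involuntory_imp_bij simp: swap_xy_def swap_xz_def)

lemma monomial3_swap:
  "monomial3 x y z (swap_xy k) = monomial3 y x z k"
  "monomial3 x y z (swap_xz k) = monomial3 z y x k"
  by (auto simp: swap_xy_def swap_xz_def monomial3_def mult_ac split: prod.splits)

lemma diff_swap:
  "xdiff (K \<circ> swap_xy) = ydiff K \<circ> swap_xy"
  "xdiff (K \<circ> swap_xz) = zdiff K \<circ> swap_xz"
  by (auto simp: swap_xy_def swap_xz_def xdiff_def ydiff_def zdiff_def fun_eq_iff)

lemma has_series_swap: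
  "has_series (K \<circ> swap_xy) y x z V \<longleftrightarrow> has_series K x y z V"
  "has_series (K \<circ> swap_xz) z y x V \<longleftrightarrow> has_series K x y z V"
  unfolding has_series_def o_def
  by (rule has_sum_reindex_bij_betw[OF bij_swap(1), of "\<lambda>k. monomial3 x y z k *\<^sub>M K k" V,
        unfolded monomial3_swap],
      rule has_sum_reindex_bij_betw[OF bij_swap(2), of "\<lambda>k. monomial3 x y z k *\<^sub>M K k" V,
        unfolded monomial3_swap])

lemma abs_conv_swap:
  "abs_conv (K \<circ> swap_xy) s r t \<longleftrightarrow> abs_conv K r s t"
  "abs_conv (K \<circ> swap_xz) t s r \<longleftrightarrow> abs_conv K r s t"
  unfolding abs_conv_def o_def
  by (rule summable_on_reindex_bij_betw[OF bij_swap(1),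
        of "\<lambda>k. monomial3 r s t k * norm (K k)", unfolded monomial3_swap],
      rule summable_on_reindex_bij_betw[OF bij_swap(2),
        of "\<lambda>k. monomial3 r s t k * norm (K k)", unfolded monomial3_swap])

lemma expansion_swap:
  "expansion (\<lambda>y x z. F x y z) (K \<circ> swap_xy) S R T \<longleftrightarrow> expansion F K R S T"
  "expansion (\<lambda>z y x. F x y z) (K \<circ> swap_xz) T S R \<longleftrightarrow> expansion F K R S T"
  unfolding expansion_def has_series_swap abs_conv_swap by (intro conj_cong; metis)+

lemma norm_monomial3: "norm (monomial3 x y z k) = monomial3 (norm x) (norm y) (norm z) k"
  for x y z :: complex
  by (simp add: monomial3_def norm_mult norm_power split: prod.splits)

lemma has_seriesI:
  assumes "abs_conv K (norm x) (norm y) (norm z)"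
  shows "has_series K x y z (\<Sum>\<^sub>\<infinity>k. monomial3 x y z k *\<^sub>M K k)"
proof -
  have "(\<lambda>k. norm (monomial3 x y z k *\<^sub>M K k)) summable_on UNIV"
    using assms by (simp add: abs_conv_def norm_cscale norm_monomial3)
  then show ?thesis
    unfolding has_series_def by (rule has_sum_infsum[OF abs_summable_summable])
qed

lemma abs_conv_xdiff:
  assumes "abs_conv K r' s t" "0 \<le> r" "r < r'" "0 \<le> s" "0 \<le> t"
  shows "abs_conv (xdiff K) r s t"
proof -
  define g where "g = (\<lambda>(m, n, p). s ^ n * t ^ p * norm (K (m, n, p)))"
  have "(\<lambda>(m, k). g (m, k) * r' ^ m) summable_on UNIV"
    using assms(1) by (simp add: abs_conv_def g_def monomial3_def case_prod_unfold mult_ac)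
  moreover have "\<And>q. 0 \<le> g q" using assms by (auto simp: g_def)
  ultimately have "(\<lambda>(m, k). real (Suc m) * g (Suc m, k) * r ^ m) summable_on UNIV"
    using assms by (intro summable_on_shifted_coefficients)
  then show ?thesis
    by (simp add: abs_conv_def g_def monomial3_def xdiff_def case_prod_unfold norm_cscale mult_ac
        del: of_nat_Suc)
qed

lemma has_sum_vec_nth:
  fixes f :: "'k \<Rightarrow> 'b::real_normed_vector^'n"
  assumes "(f has_sum V) A"
  shows "((\<lambda>k. f k $ i) has_sum V $ i) A"
  using has_sum_bounded_linear[OF bounded_linear_vec_nth assms] by (simp add: o_def)

text \<open>With \<open>y\<close> and \<open>z\<close> fixed, each matrix entry is a series in powers of one variable whose
  coefficients are indexed by the pair \<open>(n, p)\<close> besides \<open>m\<close>.\<close>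

lemma has_field_derivative_expansion:
  assumes F: "expansion F K R S T" and xyz: "norm x < R" "norm y < S" "norm z < T"
    and V: "has_series (xdiff K) x y z V"
  shows "((\<lambda>t. F t y z $ i $ j) has_field_derivative V $ i $ j) (at x)"
proof -
  define c where "c = (\<lambda>(m, n, p). y ^ n * z ^ p * K (m, n, p) $ i $ j)"
  have entry: "norm (K k $ i $ j) \<le> norm (K k)" for k
    using Finite_Cartesian_Product.norm_nth_le[of "K k" i]
      Finite_Cartesian_Product.norm_nth_le[of "K k $ i" j] by linarith
  have conv: "(\<lambda>(m, k). norm (c (m, k)) * r ^ m) summable_on UNIV" if "0 \<le> r" "r < R" for r
  proof -
    have "abs_conv K r (norm y) (norm z)"
      using F xyz that by (auto simp: expansion_def)
    then show ?thesis
      unfolding abs_conv_def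
    proof (rule summable_on_comparison_test)
      fix q :: "nat \<times> nat \<times> nat"
      obtain m n p where q: "q = (m, n, p)" by (cases q)
      show "(case q of (m, k) \<Rightarrow> norm (c (m, k)) * r ^ m)
          \<le> monomial3 r (norm y) (norm z) q * norm (K q)"
        using mult_left_mono[OF entry[of q], of "r ^ m * (norm y ^ n * norm z ^ p)"] that
        by (simp add: q c_def monomial3_def norm_mult norm_power mult_ac)
      show "0 \<le> (case q of (m, k) \<Rightarrow> norm (c (m, k)) * r ^ m)"
        using that by (simp add: q)
    qed
  qed
  have "((\<lambda>t. \<Sum>\<^sub>\<infinity>(m, k). c (m, k) * t ^ m) has_field_derivative
      (\<Sum>\<^sub>\<infinity>(m, k). of_nat (Suc m) * c (Suc m, k) * x ^ m)) (at x)"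
    using conv xyz(1) by (rule has_field_derivative_infsum_powers)
  moreover have "(\<Sum>\<^sub>\<infinity>(m, k). of_nat (Suc m) * c (Suc m, k) * x ^ m) = V $ i $ j"
    using has_sum_vec_nth[OF has_sum_vec_nth[OF V[unfolded has_series_def]], of i j]
    by (intro infsumI)
      (simp add: xdiff_def c_def monomial3_def case_prod_unfold mult_ac del: of_nat_Suc)
  moreover have "(\<Sum>\<^sub>\<infinity>(m, k). c (m, k) * t ^ m) = F t y z $ i $ j" if "t \<in> ball 0 R" for t
  proof -
    have "has_series K t y z (F t y z)"
      using F xyz that by (auto simp: expansion_def)
    from has_sum_vec_nth[OF has_sum_vec_nth[OF this[unfolded has_series_def]], of i j]
    show ?thesis
      by (intro infsumI) (simp add: c_def monomial3_def case_prod_unfold mult_ac)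
  qed
  ultimately show ?thesis
    using xyz(1) by (auto intro: has_field_derivative_transform_within_open[where S = "ball 0 R"])
qed

text \<open>The conclusion is again an expansion with the same radii, for \<open>pdx F\<close> itself. Since the equality holds
  on a whole polydisc, the lemma can be applied to its own conclusion, which yields all higher
  partial derivatives.\<close>

lemma expansion_xdiff:
  assumes F: "expansion F K R S T"
  shows "expansion (pdx F) (xdiff K) R S T"
    and "norm x < R \<Longrightarrow> norm y < S \<Longrightarrow> norm z < T \<Longrightarrow> mdifferentiable (\<lambda>t. F t y z) x"
proof -
  have conv: "abs_conv (xdiff K) r s t"
    if "0 \<le> r" "r < R" "0 \<le> s" "s < S" "0 \<le> t" "t < T" for r s t
  proof -
    \<comment> \<open>There is room for a larger radius still below \<open>R\<close>, as the passage to the derivative needs.\<close>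
    obtain r' where "r < r'" "r' < R" using dense \<open>r < R\<close> by blast
    then show ?thesis
      using that F by (intro abs_conv_xdiff[of K r']) (auto simp: expansion_def)
  qed
  have deriv: "((\<lambda>t. F t y z $ i $ j) has_field_derivative
      (\<Sum>\<^sub>\<infinity>k. monomial3 x y z k *\<^sub>M xdiff K k) $ i $ j) (at x)"
    if "norm x < R" "norm y < S" "norm z < T" for x y z i j
    using that conv by (intro has_field_derivative_expansion[OF F] has_seriesI) auto
  have "has_series (xdiff K) x y z (pdx F x y z)"
    if "norm x < R" "norm y < S" "norm z < T" for x y z
  proof -
    have "pdx F x y z = (\<Sum>\<^sub>\<infinity>k. monomial3 x y z k *\<^sub>M xdiff K k)"
      using deriv[OF that] by (simp add: pdx_def mderiv_def vec_eq_iff DERIV_imp_deriv)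
    then show ?thesis using that conv by (simp add: has_seriesI)
  qed
  with conv show "expansion (pdx F) (xdiff K) R S T"
    by (simp add: expansion_def)
  show "mdifferentiable (\<lambda>t. F t y z) x" if "norm x < R" "norm y < S" "norm z < T"
    using deriv[OF that] by (auto simp: mdifferentiable_def field_differentiable_def)
qed

lemma expansion_ydiff:
  assumes F: "expansion F K R S T"
  shows "expansion (pdy F) (ydiff K) R S T"
    and "norm x < R \<Longrightarrow> norm y < S \<Longrightarrow> norm z < T \<Longrightarrow> mdifferentiable (\<lambda>t. F x t z) y"
proof -
  have *: "expansion (\<lambda>y x z. F x y z) (K \<circ> swap_xy) S R T"
    using F by (simp add: expansion_swap)
  have "pdx (\<lambda>y x z. F x y z) = (\<lambda>y x z. pdy F x y z)"
    by (simp add: fun_eq_iff pdx_def pdy_def)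
  with expansion_xdiff(1)[OF *] show "expansion (pdy F) (ydiff K) R S T"
    by (simp add: diff_swap expansion_swap)
  show "mdifferentiable (\<lambda>t. F x t z) y" if "norm x < R" "norm y < S" "norm z < T"
    using expansion_xdiff(2)[OF *] that by simp
qed

lemma expansion_zdiff:
  assumes F: "expansion F K R S T"
  shows "expansion (pdz F) (zdiff K) R S T"
    and "norm x < R \<Longrightarrow> norm y < S \<Longrightarrow> norm z < T \<Longrightarrow> mdifferentiable (\<lambda>t. F x y t) z"
proof -
  have *: "expansion (\<lambda>z y x. F x y z) (K \<circ> swap_xz) T S R"
    using F by (simp add: expansion_swap)
  have "pdx (\<lambda>z y x. F x y z) = (\<lambda>z y x. pdz F x y z)"
    by (simp add: fun_eq_iff pdx_def pdz_def)
  with expansion_xdiff(1)[OF *] show "expansion (pdz F) (zdiff K) R S T"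
    by (simp add: diff_swap expansion_swap)
  show "mdifferentiable (\<lambda>t. F x y t) z" if "norm x < R" "norm y < S" "norm z < T"
    using expansion_xdiff(2)[OF *] that by simp
qed

lemma expansion_has_partials:
  assumes "expansion F K R S T" "norm x < R" "norm y < S" "norm z < T"
  shows "has_partials F x y z"
  unfolding has_partials_def
  using expansion_xdiff(2)[OF assms] expansion_ydiff(2)[OF assms] expansion_zdiff(2)[OF assms]
  by (intro conjI)

lemma expansion_has_partials2:
  assumes "expansion F K R S T" "norm x < R" "norm y < S" "norm z < T"
  shows "has_partials2 F x y z"
  unfolding has_partials2_def
  using expansion_xdiff(1)[OF assms(1)] expansion_ydiff(1)[OF assms(1)]
    expansion_zdiff(1)[OF assms(1)] assms
  by (auto intro: expansion_has_partials)

section \<open>Linear operations and Euler operators on series\<close>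

lemma has_series_add:
  assumes "has_series K x y z V" "has_series L x y z W"
  shows "has_series (\<lambda>k. K k + L k) x y z (V + W)"
  using has_sum_add[OF assms[unfolded has_series_def]]
  by (simp add: has_series_def linear_add[OF linear_cscale])

lemma has_series_cscale:
  assumes "has_series K x y z V"
  shows "has_series (\<lambda>k. c *\<^sub>M K k) x y z (c *\<^sub>M V)"
  using has_sum_bounded_linear[OF linear_conv_bounded_linear[THEN iffD1, OF linear_cscale]
      assms[unfolded has_series_def], of c]
  by (simp add: has_series_def o_def cscale_cscale mult.commute)

lemma has_series_diff:
  assumes "has_series K x y z V" "has_series L x y z W"
  shows "has_series (\<lambda>k. K k - L k) x y z (V - W)"
proof -
  have "- 1 *\<^sub>M A = - A" for A :: "complex^'a^'a"
    by (simp add: vec_eq_iff)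
  then show ?thesis
    using has_series_add[OF assms(1) has_series_cscale[OF assms(2), of "- 1"]] by simp
qed

lemma has_series_mult_left:
  assumes "has_series K x y z V"
  shows "has_series (\<lambda>k. A ** K k) x y z (A ** V)"
  using has_sum_bounded_linear[OF linear_conv_bounded_linear[THEN iffD1, OF linear_mult_left]
      assms[unfolded has_series_def], of A]
  by (simp add: has_series_def o_def cscale_mult_right)

lemma has_series_mult_right:
  assumes "has_series K x y z V"
  shows "has_series (\<lambda>k. K k ** A) x y z (V ** A)"
  using has_sum_bounded_linear[OF linear_conv_bounded_linear[THEN iffD1, OF linear_mult_right]
      assms[unfolded has_series_def], of A]
  by (simp add: has_series_def o_def cscale_mult_left)

lemma has_series_zero_coeffs:
  assumes "has_series K x y z V" and "\<And>m n p. K (m, n, p) = 0"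
  shows "V = 0"
proof -
  have "K k = 0" for k using assms(2) by (cases k) auto
  then have "((\<lambda>k :: nat \<times> nat \<times> nat. 0) has_sum V) UNIV"
    using assms(1) by (simp add: has_series_def linear_0[OF linear_cscale])
  then show ?thesis by (rule has_sum_unique) simp
qed

abbreviation deg_x :: "nat \<times> nat \<times> nat \<Rightarrow> complex"
  where "deg_x k \<equiv> of_nat (fst k)"

abbreviation deg_y :: "nat \<times> nat \<times> nat \<Rightarrow> complex"
  where "deg_y k \<equiv> of_nat (fst (snd k))"

abbreviation deg_z :: "nat \<times> nat \<times> nat \<Rightarrow> complex"
  where "deg_z k \<equiv> of_nat (snd (snd k))"

text \<open>The Euler operator \<open>x \<partial>/\<partial>x\<close> multiplies the coefficient of \<open>x\<^sup>m\<close> by \<open>m\<close>: multiplication by \<open>x\<close> undoes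
  the shift of the index made by differentiation, and the missing terms with \<open>m = 0\<close> are zero.\<close>

lemma has_series_xdiff_times:
  assumes V: "has_series (xdiff K) x y z V"
  shows "has_series (\<lambda>k. deg_x k *\<^sub>M K k) x y z (x *\<^sub>M V)"
proof -
  define h where "h = (\<lambda>(m :: nat, n :: nat, p :: nat). (Suc m, n, p))"
  define g where "g k = monomial3 x y z k *\<^sub>M deg_x k *\<^sub>M K k" for k
  have "((\<lambda>k. monomial3 x y z k *\<^sub>M x *\<^sub>M xdiff K k) has_sum x *\<^sub>M V) UNIV"
    using has_series_cscale[OF V, of x] by (simp add: has_series_def)
  moreover have "(\<lambda>k. monomial3 x y z k *\<^sub>M x *\<^sub>M xdiff K k) = g \<circ> h"
    by (auto simp: fun_eq_iff monomial3_def xdiff_def g_def h_def cscale_cscale mult_ac)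
  ultimately have "(g \<circ> h has_sum x *\<^sub>M V) UNIV" by simp
  moreover have "inj h" by (auto simp: h_def inj_on_def)
  ultimately have "(g has_sum x *\<^sub>M V) (range h)"
    by (simp add: has_sum_reindex)
  moreover have "g k = 0" if "k \<notin> range h" for k
  proof -
    have "fst k \<noteq> Suc m" for m
      using that rangeI[of h "(m, snd k)"] by (cases k) (auto simp: h_def)
    then have "fst k = 0" by (cases "fst k") auto
    then show ?thesis by (simp add: g_def vec_eq_iff)
  qed
  ultimately have "(g has_sum x *\<^sub>M V) UNIV"
    by (subst has_sum_cong_neutral[where S = UNIV and T = "range h" and g = g]) auto
  then show ?thesis by (simp add: has_series_def g_def[abs_def])
qed

lemma has_series_ydiff_times:
  assumes V: "has_series (ydiff K) x y z V"
  shows "has_series (\<lambda>k. deg_y k *\<^sub>M K k) x y z (y *\<^sub>M V)"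
proof -
  have "has_series (xdiff (K \<circ> swap_xy)) y x z V"
    using V by (simp add: diff_swap has_series_swap)
  from has_series_xdiff_times[OF this]
  have "has_series ((\<lambda>k. deg_y k *\<^sub>M K k) \<circ> swap_xy) y x z (y *\<^sub>M V)"
    by (simp add: o_def swap_xy_def case_prod_unfold)
  then show ?thesis by (simp only: has_series_swap)
qed

lemma has_series_zdiff_times:
  assumes V: "has_series (zdiff K) x y z V"
  shows "has_series (\<lambda>k. deg_z k *\<^sub>M K k) x y z (z *\<^sub>M V)"
proof -
  have "has_series (xdiff (K \<circ> swap_xz)) z y x V"
    using V by (simp add: diff_swap has_series_swap)
  from has_series_xdiff_times[OF this]
  have "has_series ((\<lambda>k. deg_z k *\<^sub>M K k) \<circ> swap_xz) z y x (z *\<^sub>M V)"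
    by (simp add: o_def swap_xz_def case_prod_unfold)
  then show ?thesis by (simp only: has_series_swap)
qed

text \<open>All six follow by applying Euler operators twice. In the pure cases this uses \<open>\<theta> \<partial> = \<partial> (\<theta> - 1)\<close> for
  \<open>\<theta> = x \<partial>/\<partial>x\<close>, \<open>\<partial> = \<partial>/\<partial>x\<close>, whence \<open>x\<^sup>2 \<partial>\<^sup>2 = \<theta> (\<theta> - 1)\<close>; in the mixed cases the operators for different
  variables commute.\<close>

lemma has_series_second_order:
  shows "has_series (xdiff (xdiff K)) x y z V \<Longrightarrow>
      has_series (\<lambda>k. (deg_x k * (deg_x k - 1)) *\<^sub>M K k) x y z (x *\<^sub>M x *\<^sub>M V)"
    and "has_series (ydiff (ydiff K)) x y z V \<Longrightarrow>
      has_series (\<lambda>k. (deg_y k * (deg_y k - 1)) *\<^sub>M K k) x y z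
        (y *\<^sub>M y *\<^sub>M V)"
    and "has_series (zdiff (zdiff K)) x y z V \<Longrightarrow>
      has_series (\<lambda>k. (deg_z k * (deg_z k - 1)) *\<^sub>M K k) x y z
        (z *\<^sub>M z *\<^sub>M V)"
    and "has_series (xdiff (ydiff K)) x y z V \<Longrightarrow>
      has_series (\<lambda>k. (deg_y k * deg_x k) *\<^sub>M K k) x y z (y *\<^sub>M x *\<^sub>M V)"
    and "has_series (ydiff (zdiff K)) x y z V \<Longrightarrow>
      has_series (\<lambda>k. (deg_z k * deg_y k) *\<^sub>M K k) x y z
        (z *\<^sub>M y *\<^sub>M V)"
    and "has_series (xdiff (zdiff K)) x y z V \<Longrightarrow>
      has_series (\<lambda>k. (deg_z k * deg_x k) *\<^sub>M K k) x y z (z *\<^sub>M x *\<^sub>M V)"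
proof -
  have eq: "(\<lambda>k. deg_x k *\<^sub>M xdiff K k)
      = xdiff (\<lambda>k. (deg_x k - 1) *\<^sub>M K k)"
    by (auto simp: fun_eq_iff xdiff_def cscale_cscale mult_ac)
  show "has_series (\<lambda>k. (deg_x k * (deg_x k - 1)) *\<^sub>M K k) x y z (x *\<^sub>M x *\<^sub>M V)"
    if "has_series (xdiff (xdiff K)) x y z V"
    using has_series_xdiff_times[OF has_series_xdiff_times[OF that, unfolded eq]]
    by (simp add: cscale_cscale)
  have eq: "(\<lambda>k. deg_y k *\<^sub>M ydiff K k)
      = ydiff (\<lambda>k. (deg_y k - 1) *\<^sub>M K k)"
    by (auto simp: fun_eq_iff ydiff_def cscale_cscale mult_ac)
  show "has_series (\<lambda>k. (deg_y k * (deg_y k - 1)) *\<^sub>M K k) x y z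
        (y *\<^sub>M y *\<^sub>M V)"
    if "has_series (ydiff (ydiff K)) x y z V"
    using has_series_ydiff_times[OF has_series_ydiff_times[OF that, unfolded eq]]
    by (simp add: cscale_cscale)
  have eq: "(\<lambda>k. deg_z k *\<^sub>M zdiff K k)
      = zdiff (\<lambda>k. (deg_z k - 1) *\<^sub>M K k)"
    by (auto simp: fun_eq_iff zdiff_def cscale_cscale mult_ac)
  show "has_series (\<lambda>k. (deg_z k * (deg_z k - 1)) *\<^sub>M K k) x y z
        (z *\<^sub>M z *\<^sub>M V)"
    if "has_series (zdiff (zdiff K)) x y z V"
    using has_series_zdiff_times[OF has_series_zdiff_times[OF that, unfolded eq]]
    by (simp add: cscale_cscale)
  have eq: "(\<lambda>k. deg_x k *\<^sub>M ydiff K k) = ydiff (\<lambda>k. deg_x k *\<^sub>M K k)"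
    by (auto simp: fun_eq_iff ydiff_def cscale_cscale mult_ac)
  show "has_series (\<lambda>k. (deg_y k * deg_x k) *\<^sub>M K k) x y z (y *\<^sub>M x *\<^sub>M V)"
    if "has_series (xdiff (ydiff K)) x y z V"
    using has_series_ydiff_times[OF has_series_xdiff_times[OF that, unfolded eq]]
    by (simp add: cscale_cscale)
  have eq: "(\<lambda>k. deg_y k *\<^sub>M zdiff K k) = zdiff (\<lambda>k. deg_y k *\<^sub>M K k)"
    by (auto simp: fun_eq_iff zdiff_def cscale_cscale mult_ac)
  show "has_series (\<lambda>k. (deg_z k * deg_y k) *\<^sub>M K k) x y z
        (z *\<^sub>M y *\<^sub>M V)"
    if "has_series (ydiff (zdiff K)) x y z V"
    using has_series_zdiff_times[OF has_series_ydiff_times[OF that, unfolded eq]]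
    by (simp add: cscale_cscale)
  have eq: "(\<lambda>k. deg_x k *\<^sub>M zdiff K k) = zdiff (\<lambda>k. deg_x k *\<^sub>M K k)"
    by (auto simp: fun_eq_iff zdiff_def cscale_cscale mult_ac)
  show "has_series (\<lambda>k. (deg_z k * deg_x k) *\<^sub>M K k) x y z (z *\<^sub>M x *\<^sub>M V)"
    if "has_series (xdiff (zdiff K)) x y z V"
    using has_series_zdiff_times[OF has_series_xdiff_times[OF that, unfolded eq]]
    by (simp add: cscale_cscale)
qed

section \<open>The recurrences of the coefficients\<close>

locale F3_parameters =
  fixes A1 A2 B1 B2 C1 C2 C3 :: "complex^'d^'d"
  assumes invertible_C1: "\<And>k. invertible (C1 + mat (of_nat k))"
    and invertible_C2: "\<And>k. invertible (C2 + mat (of_nat k))"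
    and invertible_C3: "\<And>k. invertible (C3 + mat (of_nat k))"
    and A1_A2: "A1 ** A2 = A2 ** A1"
    and B1_B2: "B1 ** B2 = B2 ** B1"
    and B_C: "\<And>B C. B \<in> {B1, B2} \<Longrightarrow> C \<in> {C1, C2, C3} \<Longrightarrow> B ** C = C ** B"
    and C_C: "\<And>C D. C \<in> {C1, C2, C3} \<Longrightarrow> D \<in> {C1, C2, C3} \<Longrightarrow> C ** D = D ** C"
begin

definition F3_product :: "'d coeffs"
  where "F3_product = (\<lambda>(m, n, p).
    mpoch A1 m ** mpoch A2 (n + p) ** mpoch B1 (m + p) ** mpoch B2 n
      ** matrix_inv (mpoch C1 m) ** matrix_inv (mpoch C2 n) ** matrix_inv (mpoch C3 p))"

definition F3_coeff :: "'d coeffs"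
  where "F3_coeff = (\<lambda>(m, n, p). (1 / (fact m * fact n * fact p)) *\<^sub>M F3_product (m, n, p))"

lemma F3_term_eq: "F3_term A1 A2 B1 B2 C1 C2 C3 x y z k = monomial3 x y z k *\<^sub>M F3_coeff k"
  by (simp add: F3_term_def monomial3_def F3_coeff_def F3_product_def cscale_cscale
      split: prod.splits)

lemma B_inv_commute:
  assumes "B \<in> {B1, B2}" "C \<in> {C1, C2, C3}"
  shows "(B + mat c) ** matrix_inv (mpoch C k) = matrix_inv (mpoch C k) ** (B + mat c)"
proof -
  have "invertible (mpoch C k)"
    using assms(2) invertible_C1 invertible_C2 invertible_C3 by (auto intro: invertible_mpoch)
  moreover have "(B + mat c) ** mpoch C k = mpoch C k ** (B + mat c)"
    using commute_add_mat[OF B_C[OF assms, symmetric]] by (intro commute_mpoch) simp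
  ultimately show ?thesis by (rule commute_matrix_inv)
qed

lemma C_inv_commute:
  assumes "D \<in> {C1, C2, C3}" "C \<in> {C1, C2, C3}"
  shows "matrix_inv (mpoch C k) ** (D + mat c) = (D + mat c) ** matrix_inv (mpoch C k)"
proof -
  have "invertible (mpoch C k)"
    using assms(2) invertible_C1 invertible_C2 invertible_C3 by (auto intro: invertible_mpoch)
  moreover have "(D + mat c) ** mpoch C k = mpoch C k ** (D + mat c)"
    using commute_add_mat[OF C_C[OF assms(2,1)]] by (intro commute_mpoch) simp
  ultimately show ?thesis using commute_matrix_inv by metis
qed

lemma A_poch_commute: "mpoch A1 k ** (A2 + mat c) = (A2 + mat c) ** mpoch A1 k"
  using commute_mpoch[of "A2 + mat c" A1 k] commute_add_mat[OF A1_A2] by simp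

lemma B_poch_commute: "(B1 + mat c) ** mpoch B2 k = mpoch B2 k ** (B1 + mat c)"
  using commute_mpoch[of "B1 + mat c" B2 k] commute_add_mat[OF B1_B2[symmetric]] by simp

lemmas B_right = B_inv_commute[of B1] B_inv_commute[of B2] B_poch_commute

text \<open>In each identity a factor \<open>P\<close>, which the longer symbol of \<open>A\<^sub>1\<close> or \<open>A\<^sub>2\<close> contributes, moves to the
  left end; a factor \<open>Q\<close> from the longer symbol of \<open>B\<^sub>1\<close> or \<open>B\<^sub>2\<close> moves to the right end; and \<open>D\<close>, a shift
  of one of the \<open>C\<^sub>j\<close>, moves from the right end to the left until it meets the inverse \<open>i\<close> that it
  shortens.\<close>

lemma F3_product_Suc:
  shows "F3_product (Suc m, n, p) ** (C1 + mat (of_nat m))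
      = (A1 + mat (of_nat m)) ** F3_product (m, n, p) ** (B1 + mat (of_nat (m + p)))"
    and "F3_product (m, Suc n, p) ** (C2 + mat (of_nat n))
      = (A2 + mat (of_nat (n + p))) ** F3_product (m, n, p) ** (B2 + mat (of_nat n))"
    and "F3_product (m, n, Suc p) ** (C3 + mat (of_nat p))
      = (A2 + mat (of_nat (n + p))) ** F3_product (m, n, p) ** (B1 + mat (of_nat (m + p)))"
proof -
  define a1 a2 b1 b2 where "a1 = mpoch A1 m" and "a2 = mpoch A2 (n + p)"
    and "b1 = mpoch B1 (m + p)" and "b2 = mpoch B2 n"
  define i1 i2 i3 where "i1 = matrix_inv (mpoch C1 m)" and "i2 = matrix_inv (mpoch C2 n)"
    and "i3 = matrix_inv (mpoch C3 p)"
  note defs = a1_def a2_def b1_def b2_def i1_def i2_def i3_def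
  have product: "F3_product (m, n, p) = a1 ** a2 ** b1 ** b2 ** i1 ** i2 ** i3"
    by (simp add: F3_product_def defs)
  show "F3_product (Suc m, n, p) ** (C1 + mat (of_nat m))
      = (A1 + mat (of_nat m)) ** F3_product (m, n, p) ** (B1 + mat (of_nat (m + p)))"
  proof -
    define P Q D i where "P = A1 + mat (of_nat m)" and "Q = B1 + mat (of_nat (m + p))"
      and "D = C1 + mat (of_nat m)" and "i = matrix_inv (mpoch C1 (Suc m))"
    have expand: "F3_product (Suc m, n, p) = P ** a1 ** a2 ** (b1 ** Q) ** b2 ** i ** i2 ** i3"
      by (simp add: F3_product_def defs P_def Q_def i_def mpoch_Suc_left[of A1] del: mpoch.simps(2))
        (simp add: matrix_mul_assoc)
    have absorb: "i ** D = i1"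
      unfolding defs D_def i_def by (intro matrix_inv_mpoch_Suc invertible_C1)
    have D: "i2 ** D = D ** i2" "i3 ** D = D ** i3"
      unfolding defs D_def by (intro C_inv_commute; simp)+
    have Q: "Q ** b2 = b2 ** Q" "Q ** i1 = i1 ** Q" "Q ** i2 = i2 ** Q" "Q ** i3 = i3 ** Q"
      unfolding defs Q_def by (auto intro: B_right)
    show ?thesis
      unfolding product P_def[symmetric] Q_def[symmetric] D_def[symmetric] expand
      by (simp add: D D[THEN swap_in_product] Q Q[THEN swap_in_product]
          absorb absorb[THEN absorb_in_product] flip: matrix_mul_assoc)
  qed
  show "F3_product (m, Suc n, p) ** (C2 + mat (of_nat n))
      = (A2 + mat (of_nat (n + p))) ** F3_product (m, n, p) ** (B2 + mat (of_nat n))"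
  proof -
    define P Q D i where "P = A2 + mat (of_nat (n + p))" and "Q = B2 + mat (of_nat n)"
      and "D = C2 + mat (of_nat n)" and "i = matrix_inv (mpoch C2 (Suc n))"
    have expand: "F3_product (m, Suc n, p) = a1 ** (P ** a2) ** b1 ** (b2 ** Q) ** i1 ** i ** i3"
      by (simp add: F3_product_def defs P_def Q_def i_def mpoch_Suc_left[of A2] del: mpoch.simps(2))
        (simp add: matrix_mul_assoc)
    have absorb: "i ** D = i2"
      unfolding defs D_def i_def by (intro matrix_inv_mpoch_Suc invertible_C2)
    have D: "i3 ** D = D ** i3"
      unfolding defs D_def by (intro C_inv_commute; simp)
    have Q: "Q ** i1 = i1 ** Q" "Q ** i2 = i2 ** Q" "Q ** i3 = i3 ** Q"
      unfolding defs Q_def by (auto intro: B_right)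
    have P: "a1 ** P = P ** a1"
      unfolding defs P_def by (rule A_poch_commute)
    show ?thesis
      unfolding product P_def[symmetric] Q_def[symmetric] D_def[symmetric] expand
      by (simp add: P P[THEN swap_in_product] D D[THEN swap_in_product] Q Q[THEN swap_in_product]
          absorb absorb[THEN absorb_in_product] flip: matrix_mul_assoc)
  qed
  show "F3_product (m, n, Suc p) ** (C3 + mat (of_nat p))
      = (A2 + mat (of_nat (n + p))) ** F3_product (m, n, p) ** (B1 + mat (of_nat (m + p)))"
  proof -
    define P Q D i where "P = A2 + mat (of_nat (n + p))" and "Q = B1 + mat (of_nat (m + p))"
      and "D = C3 + mat (of_nat p)" and "i = matrix_inv (mpoch C3 (Suc p))"
    have expand: "F3_product (m, n, Suc p) = a1 ** (P ** a2) ** (b1 ** Q) ** b2 ** i1 ** i2 ** i"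
      by (simp add: F3_product_def defs P_def Q_def i_def mpoch_Suc_left[of A2] del: mpoch.simps(2))
        (simp add: matrix_mul_assoc)
    have absorb: "i ** D = i3"
      unfolding defs D_def i_def by (intro matrix_inv_mpoch_Suc invertible_C3)
    have Q: "Q ** b2 = b2 ** Q" "Q ** i1 = i1 ** Q" "Q ** i2 = i2 ** Q" "Q ** i3 = i3 ** Q"
      unfolding defs Q_def by (auto intro: B_right)
    have P: "a1 ** P = P ** a1"
      unfolding defs P_def by (rule A_poch_commute)
    show ?thesis
      unfolding product P_def[symmetric] Q_def[symmetric] D_def[symmetric] expand
      by (simp add: P P[THEN swap_in_product] Q Q[THEN swap_in_product]
          absorb absorb[THEN absorb_in_product] flip: matrix_mul_assoc)
  qed
qed

text \<open>The factor \<open>m + 1\<close> from differentiation turns \<open>1 / (m + 1)!\<close> into \<open>1 / m!\<close>, so both sides carry the same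
  factorials and only the matrix products differ.\<close>

lemma F3_coeff_recurrence:
  shows "xdiff F3_coeff (m, n, p) ** (C1 + mat (of_nat m))
      = (A1 + mat (of_nat m)) ** F3_coeff (m, n, p) ** (B1 + mat (of_nat (m + p)))"
    and "ydiff F3_coeff (m, n, p) ** (C2 + mat (of_nat n))
      = (A2 + mat (of_nat (n + p))) ** F3_coeff (m, n, p) ** (B2 + mat (of_nat n))"
    and "zdiff F3_coeff (m, n, p) ** (C3 + mat (of_nat p))
      = (A2 + mat (of_nat (n + p))) ** F3_coeff (m, n, p) ** (B1 + mat (of_nat (m + p)))"
proof -
  define c :: complex where "c = 1 / (fact m * fact n * fact p)"
  have "xdiff F3_coeff (m, n, p) = c *\<^sub>M F3_product (Suc m, n, p)"
    and "ydiff F3_coeff (m, n, p) = c *\<^sub>M F3_product (m, Suc n, p)"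
    and "zdiff F3_coeff (m, n, p) = c *\<^sub>M F3_product (m, n, Suc p)"
    by (simp_all add: xdiff_def ydiff_def zdiff_def F3_coeff_def c_def cscale_cscale mult.assoc
        del: of_nat_Suc)
  moreover have "F3_coeff (m, n, p) = c *\<^sub>M F3_product (m, n, p)"
    by (simp add: F3_coeff_def c_def)
  ultimately show
    "xdiff F3_coeff (m, n, p) ** (C1 + mat (of_nat m))
      = (A1 + mat (of_nat m)) ** F3_coeff (m, n, p) ** (B1 + mat (of_nat (m + p)))"
    "ydiff F3_coeff (m, n, p) ** (C2 + mat (of_nat n))
      = (A2 + mat (of_nat (n + p))) ** F3_coeff (m, n, p) ** (B2 + mat (of_nat n))"
    "zdiff F3_coeff (m, n, p) ** (C3 + mat (of_nat p))
      = (A2 + mat (of_nat (n + p))) ** F3_coeff (m, n, p) ** (B1 + mat (of_nat (m + p)))"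
    by (simp_all only: cscale_mult_left cscale_mult_right F3_product_Suc)
qed

end

section \<open>A polydisc around an interior point\<close>

lemma (in F3_parameters) abs_conv_F3_coeff:
  assumes "(x, y, z) \<in> F3_region A1 A2 B1 B2 C1 C2 C3"
  shows "abs_conv F3_coeff (norm x) (norm y) (norm z)"
  using assms
  by (simp add: F3_region_def abs_conv_def F3_term_eq[abs_def] norm_cscale norm_monomial3)

lemma monomial3_mono:
  fixes r s t :: real
  assumes "0 \<le> r" "r \<le> r'" "0 \<le> s" "s \<le> s'" "0 \<le> t" "t \<le> t'"
  shows "monomial3 r s t k \<le> monomial3 r' s' t' k"
  using assms by (auto simp: monomial3_def intro!: mult_mono power_mono split: prod.splits)

lemma abs_conv_mono:
  assumes "abs_conv K r' s' t'" and le: "0 \<le> r" "r \<le> r'" "0 \<le> s" "s \<le> s'" "0 \<le> t" "t \<le> t'"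
  shows "abs_conv K r s t"
  unfolding abs_conv_def
proof (rule summable_on_comparison_test[OF assms(1)[unfolded abs_conv_def]])
  show "monomial3 r s t k * norm (K k) \<le> monomial3 r' s' t' k * norm (K k)" for k
    using monomial3_mono[OF le] by (rule mult_right_mono) simp
  show "0 \<le> monomial3 r s t k * norm (K k)" for k
    using le by (auto simp: monomial3_def split: prod.splits)
qed

text \<open>A number \<open>u\<close> at distance \<open>d\<close> from \<open>x\<close> and as far from the origin as possible; for \<open>x = 0\<close> the
  direction is arbitrary.\<close>

lemma point_moved_outwards:
  fixes x :: complex
  assumes "d \<ge> 0"
  obtains u where "norm (u - x) = d" "norm u = norm x + d"
proof (cases "x = 0")
  case True
  then show ?thesis using assms that[of "of_real d"] by simp
next
  case False
  have "norm (x + of_real d * sgn x - x) = d"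
    using False assms by (simp add: norm_mult norm_sgn)
  moreover have "x + of_real d * sgn x = of_real (norm x + d) * sgn x"
    by (simp add: algebra_simps sgn_eq)
  then have "norm (x + of_real d * sgn x) = norm x + d"
    using False assms by (simp only: norm_mult norm_sgn norm_of_real) simp
  ultimately show ?thesis by (rule that)
qed

text \<open>Moving all three coordinates outwards by a small \<open>d\<close> stays in the region. The absolute values at the
  new point are the radii of a polydisc that contains the old point.\<close>

lemma (in F3_parameters) F3_expansion:
  assumes "(x, y, z) \<in> interior (F3_region A1 A2 B1 B2 C1 C2 C3)"
  obtains R S T where "norm x < R" "norm y < S" "norm z < T"
    and "expansion (F3 A1 A2 B1 B2 C1 C2 C3) F3_coeff R S T"
proof -
  obtain e where e: "e > 0" "ball (x, y, z) e \<subseteq> F3_region A1 A2 B1 B2 C1 C2 C3"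
    using assms by (auto simp: mem_interior)
  \<comment> \<open>The distance of the moved point is at most the sum \<open>3 * d\<close> of the coordinate distances.\<close>
  define d where "d = e / 4"
  have d: "d > 0" "3 * d < e" using e by (auto simp: d_def)
  obtain u where u: "norm (u - x) = d" "norm u = norm x + d"
    using point_moved_outwards[of d x] d by auto
  obtain v where v: "norm (v - y) = d" "norm v = norm y + d"
    using point_moved_outwards[of d y] d by auto
  obtain w where w: "norm (w - z) = d" "norm w = norm z + d"
    using point_moved_outwards[of d z] d by auto
  have "dist (x, y, z) (u, v, w) \<le> dist x u + dist (y, z) (v, w)"
    unfolding dist_Pair_Pair[of x] by (rule sqrt_sum_squares_le_sum) simp_all
  moreover have "dist (y, z) (v, w) \<le> dist y v + dist z w"
    unfolding dist_Pair_Pair by (rule sqrt_sum_squares_le_sum) simp_all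
  moreover have "dist x u = d" "dist y v = d" "dist z w = d"
    using u v w by (simp_all add: dist_norm norm_minus_commute)
  ultimately have "(u, v, w) \<in> ball (x, y, z) e"
    using d by simp
  then have "abs_conv F3_coeff (norm u) (norm v) (norm w)"
    using e by (intro abs_conv_F3_coeff) auto
  then have conv: "abs_conv F3_coeff r s t"
    if "0 \<le> r" "r < norm u" "0 \<le> s" "s < norm v" "0 \<le> t" "t < norm w" for r s t
    using that by (intro abs_conv_mono[of F3_coeff "norm u" "norm v" "norm w" r s t]) auto
  have "F3 A1 A2 B1 B2 C1 C2 C3 a b c = (\<Sum>\<^sub>\<infinity>k. monomial3 a b c k *\<^sub>M F3_coeff k)" for a b c
    by (simp add: F3_def F3_term_eq[abs_def])
  then have "expansion (F3 A1 A2 B1 B2 C1 C2 C3) F3_coeff (norm u) (norm v) (norm w)"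
    using conv by (simp add: expansion_def has_seriesI)
  then show ?thesis using u v w d by (intro that[of "norm u" "norm v" "norm w"]) simp_all
qed

section \<open>The differential equations\<close>

context F3_parameters
begin

text \<open>The three equations hold for any values of the series of \<open>F3_coeff\<close> and of its formal derivatives.
  In each proof \<open>?V\<close> is the left-hand side, regrouped so that every power of a variable is attached to
  the derivative with which it forms an Euler operator. Its series has zero coefficients by the
  corresponding recurrence.\<close>

lemma F3_first_equation:
  assumes U: "has_series F3_coeff x y z U"
    and Ux: "has_series (xdiff F3_coeff) x y z Ux" and Uz: "has_series (zdiff F3_coeff) x y z Uz"
    and Uxx: "has_series (xdiff (xdiff F3_coeff)) x y z Uxx"
    and Uxz: "has_series (xdiff (zdiff F3_coeff)) x y z Uxz"
  shows "(x * (1 - x)) *\<^sub>M Uxx - (x * z) *\<^sub>M Uxz + Ux ** (C1 - x *\<^sub>M (B1 + mat 1))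
      - A1 ** (x *\<^sub>M Ux + z *\<^sub>M Uz) - A1 ** U ** B1 = 0"
proof -
  have "(x * (1 - x)) *\<^sub>M Uxx - (x * z) *\<^sub>M Uxz + Ux ** (C1 - x *\<^sub>M (B1 + mat 1))
      - A1 ** (x *\<^sub>M Ux + z *\<^sub>M Uz) - A1 ** U ** B1
    = x *\<^sub>M Uxx - x *\<^sub>M x *\<^sub>M Uxx - z *\<^sub>M x *\<^sub>M Uxz + Ux ** C1 - (x *\<^sub>M Ux) ** (B1 + mat 1)
      - A1 ** (x *\<^sub>M Ux + z *\<^sub>M Uz) - A1 ** U ** B1"
    (is "_ = ?V")
    by (simp add: matrix_expand vec_eq_iff algebra_simps)
  also have "has_series (\<lambda>k. deg_x k *\<^sub>M xdiff F3_coeff k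
      - (deg_x k * (deg_x k - 1)) *\<^sub>M F3_coeff k - (deg_z k * deg_x k) *\<^sub>M F3_coeff k
      + xdiff F3_coeff k ** C1 - (deg_x k *\<^sub>M F3_coeff k) ** (B1 + mat 1)
      - A1 ** (deg_x k *\<^sub>M F3_coeff k + deg_z k *\<^sub>M F3_coeff k) - A1 ** F3_coeff k ** B1) x y z ?V"
    by (intro has_series_diff has_series_add has_series_mult_left has_series_mult_right
        has_series_xdiff_times has_series_zdiff_times has_series_second_order U Ux Uz Uxx Uxz)
  then have "?V = 0"
  proof (rule has_series_zero_coeffs, goal_cases)
    case (1 m n p)
    then show ?case using F3_coeff_recurrence(1)[where m = m and n = n and p = p]
      by (simp add: matrix_expand vec_eq_iff algebra_simps)
  qed
  finally show ?thesis .
qed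

lemma F3_second_equation:
  assumes U: "has_series F3_coeff x y z U"
    and Uy: "has_series (ydiff F3_coeff) x y z Uy" and Uz: "has_series (zdiff F3_coeff) x y z Uz"
    and Uyy: "has_series (ydiff (ydiff F3_coeff)) x y z Uyy"
    and Uyz: "has_series (ydiff (zdiff F3_coeff)) x y z Uyz"
  shows "(y * (1 - y)) *\<^sub>M Uyy - (y * z) *\<^sub>M Uyz + Uy ** (C2 - y *\<^sub>M (B2 + mat 1))
      - z *\<^sub>M Uz ** B2 - y *\<^sub>M (A2 ** Uy) - A2 ** U ** B2 = 0"
proof -
  have "(y * (1 - y)) *\<^sub>M Uyy - (y * z) *\<^sub>M Uyz + Uy ** (C2 - y *\<^sub>M (B2 + mat 1))
      - z *\<^sub>M Uz ** B2 - y *\<^sub>M (A2 ** Uy) - A2 ** U ** B2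
    = y *\<^sub>M Uyy - y *\<^sub>M y *\<^sub>M Uyy - z *\<^sub>M y *\<^sub>M Uyz + Uy ** C2 - (y *\<^sub>M Uy) ** (B2 + mat 1)
      - z *\<^sub>M Uz ** B2 - A2 ** (y *\<^sub>M Uy) - A2 ** U ** B2"
    (is "_ = ?V")
    by (simp add: matrix_expand vec_eq_iff algebra_simps)
  also have "has_series (\<lambda>k. deg_y k *\<^sub>M ydiff F3_coeff k
      - (deg_y k * (deg_y k - 1)) *\<^sub>M F3_coeff k - (deg_z k * deg_y k) *\<^sub>M F3_coeff k
      + ydiff F3_coeff k ** C2 - (deg_y k *\<^sub>M F3_coeff k) ** (B2 + mat 1)
      - (deg_z k *\<^sub>M F3_coeff k) ** B2 - A2 ** (deg_y k *\<^sub>M F3_coeff k)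
      - A2 ** F3_coeff k ** B2) x y z ?V"
    by (intro has_series_diff has_series_add has_series_mult_left has_series_mult_right
        has_series_ydiff_times has_series_zdiff_times has_series_second_order U Uy Uz Uyy Uyz)
  then have "?V = 0"
  proof (rule has_series_zero_coeffs, goal_cases)
    case (1 m n p)
    then show ?case using F3_coeff_recurrence(2)[where m = m and n = n and p = p]
      by (simp add: matrix_expand vec_eq_iff algebra_simps)
  qed
  finally show ?thesis .
qed

lemma F3_third_equation:
  assumes U: "has_series F3_coeff x y z U"
    and Ux: "has_series (xdiff F3_coeff) x y z Ux" and Uy: "has_series (ydiff F3_coeff) x y z Uy"
    and Uz: "has_series (zdiff F3_coeff) x y z Uz"
    and Uzz: "has_series (zdiff (zdiff F3_coeff)) x y z Uzz"
    and Uxy: "has_series (xdiff (ydiff F3_coeff)) x y z Uxy"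
    and Uyz: "has_series (ydiff (zdiff F3_coeff)) x y z Uyz"
    and Uxz: "has_series (xdiff (zdiff F3_coeff)) x y z Uxz"
  shows "(z * (1 - z)) *\<^sub>M Uzz - ((x * y) *\<^sub>M Uxy + (y * z) *\<^sub>M Uyz + (x * z) *\<^sub>M Uxz)
      + Uz ** (C3 - z *\<^sub>M (B1 + mat 1)) - y *\<^sub>M Uy ** B1
      - A2 ** (x *\<^sub>M Ux + z *\<^sub>M Uz) - A2 ** U ** B1 = 0"
proof -
  have "(z * (1 - z)) *\<^sub>M Uzz - ((x * y) *\<^sub>M Uxy + (y * z) *\<^sub>M Uyz + (x * z) *\<^sub>M Uxz)
      + Uz ** (C3 - z *\<^sub>M (B1 + mat 1)) - y *\<^sub>M Uy ** B1
      - A2 ** (x *\<^sub>M Ux + z *\<^sub>M Uz) - A2 ** U ** B1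
    = z *\<^sub>M Uzz - z *\<^sub>M z *\<^sub>M Uzz - (y *\<^sub>M x *\<^sub>M Uxy + z *\<^sub>M y *\<^sub>M Uyz + z *\<^sub>M x *\<^sub>M Uxz)
      + Uz ** C3 - (z *\<^sub>M Uz) ** (B1 + mat 1) - y *\<^sub>M Uy ** B1
      - A2 ** (x *\<^sub>M Ux + z *\<^sub>M Uz) - A2 ** U ** B1"
    (is "_ = ?V")
    by (simp add: matrix_expand vec_eq_iff algebra_simps)
  also have "has_series (\<lambda>k. deg_z k *\<^sub>M zdiff F3_coeff k
      - (deg_z k * (deg_z k - 1)) *\<^sub>M F3_coeff k
      - ((deg_y k * deg_x k) *\<^sub>M F3_coeff k + (deg_z k * deg_y k) *\<^sub>M F3_coeff k
          + (deg_z k * deg_x k) *\<^sub>M F3_coeff k)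
      + zdiff F3_coeff k ** C3 - (deg_z k *\<^sub>M F3_coeff k) ** (B1 + mat 1)
      - (deg_y k *\<^sub>M F3_coeff k) ** B1
      - A2 ** (deg_x k *\<^sub>M F3_coeff k + deg_z k *\<^sub>M F3_coeff k) - A2 ** F3_coeff k ** B1) x y z ?V"
    by (intro has_series_diff has_series_add has_series_mult_left has_series_mult_right
        has_series_xdiff_times has_series_ydiff_times has_series_zdiff_times
        has_series_second_order U Ux Uy Uz Uzz Uxy Uyz Uxz)
  then have "?V = 0"
  proof (rule has_series_zero_coeffs, goal_cases)
    case (1 m n p)
    then show ?case using F3_coeff_recurrence(3)[where m = m and n = n and p = p]
      by (simp add: matrix_expand vec_eq_iff algebra_simps)
  qed
  finally show ?thesis .
qed

end

theorem theorem4p2: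
  fixes A1 A2 B1 B2 C1 C2 C3 :: "complex^'d^'d"
    and U Ux Uy Uz Uxx Uyy Uzz Uxy Uyz Uxz :: "complex \<Rightarrow> complex \<Rightarrow> complex \<Rightarrow> complex^'d^'d"
    and x y z :: complex
  defines "U \<equiv> F3 A1 A2 B1 B2 C1 C2 C3"
  defines "Ux \<equiv> pdx U" and "Uy \<equiv> pdy U" and "Uz \<equiv> pdz U"
  defines "Uxx \<equiv> pdx (pdx U)" and "Uyy \<equiv> pdy (pdy U)" and "Uzz \<equiv> pdz (pdz U)"
    and "Uxy \<equiv> pdx (pdy U)" and "Uyz \<equiv> pdy (pdz U)" and "Uxz \<equiv> pdx (pdz U)"
  assumes "\<And>k::nat. invertible (C1 + mat (of_nat k))"
    and "\<And>k::nat. invertible (C2 + mat (of_nat k))"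
    and "\<And>k::nat. invertible (C3 + mat (of_nat k))"
    and "A1 ** A2 = A2 ** A1"
    and "B1 ** B2 = B2 ** B1"
    and "\<And>B C. B \<in> {B1, B2} \<Longrightarrow> C \<in> {C1, C2, C3} \<Longrightarrow> B ** C = C ** B"
    and "\<And>C D. C \<in> {C1, C2, C3} \<Longrightarrow> D \<in> {C1, C2, C3} \<Longrightarrow> C ** D = D ** C"
    and "(x, y, z) \<in> interior (F3_region A1 A2 B1 B2 C1 C2 C3)"
  shows "has_partials2 U x y z
    \<and> (x * (1 - x)) *\<^sub>M Uxx x y z - (x * z) *\<^sub>M Uxz x y z
        + Ux x y z ** (C1 - x *\<^sub>M (B1 + mat 1))
        - A1 ** (x *\<^sub>M Ux x y z + z *\<^sub>M Uz x y z)
        - A1 ** U x y z ** B1 = 0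
    \<and> (y * (1 - y)) *\<^sub>M Uyy x y z - (y * z) *\<^sub>M Uyz x y z
        + Uy x y z ** (C2 - y *\<^sub>M (B2 + mat 1))
        - z *\<^sub>M Uz x y z ** B2 - y *\<^sub>M (A2 ** Uy x y z)
        - A2 ** U x y z ** B2 = 0
    \<and> (z * (1 - z)) *\<^sub>M Uzz x y z
        - ((x * y) *\<^sub>M Uxy x y z + (y * z) *\<^sub>M Uyz x y z + (x * z) *\<^sub>M Uxz x y z)
        + Uz x y z ** (C3 - z *\<^sub>M (B1 + mat 1))
        - y *\<^sub>M Uy x y z ** B1
        - A2 ** (x *\<^sub>M Ux x y z + z *\<^sub>M Uz x y z)
        - A2 ** U x y z ** B1 = 0"
proof -
  interpret F3_parameters A1 A2 B1 B2 C1 C2 C3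
    using assms(11-17) by unfold_locales
  obtain R S T where x: "norm x < R" and y: "norm y < S" and z: "norm z < T"
    and U: "expansion U F3_coeff R S T"
    using F3_expansion[OF assms(18)] unfolding U_def by blast
  have series: "has_series K x y z (F x y z)" if "expansion F K R S T" for F K
    using that x y z by (simp add: expansion_def)
  note Ux = expansion_xdiff(1)[OF U] and Uy = expansion_ydiff(1)[OF U]
    and Uz = expansion_zdiff(1)[OF U]
  note Uxx = expansion_xdiff(1)[OF Ux] and Uyy = expansion_ydiff(1)[OF Uy]
    and Uzz = expansion_zdiff(1)[OF Uz] and Uxy = expansion_xdiff(1)[OF Uy]
    and Uyz = expansion_ydiff(1)[OF Uz] and Uxz = expansion_xdiff(1)[OF Uz]
  show ?thesis
    unfolding Ux_def Uy_def Uz_def Uxx_def Uyy_def Uzz_def Uxy_def Uyz_def Uxz_def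
    by (intro conjI expansion_has_partials2[OF U x y z] F3_first_equation[where y = y]
        F3_second_equation[where x = x] F3_third_equation
        series[OF U] series[OF Ux] series[OF Uy] series[OF Uz]
        series[OF Uxx] series[OF Uyy] series[OF Uzz] series[OF Uxy] series[OF Uyz] series[OF Uxz])
qed

end
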